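(* For all integers $m\ge1$ and $k\ge1$, $$I_{0^+}^m\left[x^{k-1}\log\Gamma(x)\right](1)=\int_{0}^{1}\int_{0}^{t_1}\cdots\int_{0}^{t_{m-1}}t_m^{k-1}\log\Gamma(t_m)\,dt_m\cdots dt_2\,dt_1=\sum_{n=0}^{m-1}(-1)^n\frac{(n+k-1)\cdots(n+1)}{(m-1-n)!}\,I_{1^-}^{n+k}\log\Gamma(0),$$ where the empty product $(n+k-1)\cdots(n+1)$ when $k=1$ is taken to be $1$.
   Context: $\Gamma$ is Euler's gamma function and $\log\Gamma(t)$ is the real logarithm for $t\in(0,1]$. For $\mathfrak{Re}(\alpha)>0$ the left- and right-sided Riemann-Liouville fractional integrals of order $\alpha$ of $f$ on $[a,b]$ are $I_{a^+}^\alpha f(x)=\frac{1}{\Gamma(\alpha)}\int_a^x (x-t)^{\alpha-1}f(t)\,dt$ ($a<x\le b$) and $I_{b^-}^\alpha f(x)=\frac{1}{\Gamma(\alpha)}\int_x^b (t-x)^{\alpha-1}f(t)\,dt$ ($a\le x<b$). Here $a=0$, $b=1$, so $I_{0^+}^m[f(x)](1)=\frac{1}{(m-1)!}\int_0^1(1-t)^{m-1}f(t)\,dt$ and, for an integer $j\ge1$, $I_{1^-}^{j}\log\Gamma(0)=\frac{1}{(j-1)!}\int_0^1 t^{j-1}\log\Gamma(t)\,dt$. For $m=1$ the repeated integral is $\int_0^1 t_1^{k-1}\log\Gamma(t_1)\,dt_1$. The product $(n+k-1)\cdots(n+1)$ is $\frac{(n+k-1)!}{n!}$. *)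

theory Defs
  imports "HOL-Analysis.Analysis"
begin

(* Riemann-Liouville fractional integrals of complex order alpha, meaningful for Re alpha > 0
   and x in ]a, b] (left-sided), x in [a, b[ (right-sided). The opposite end point of [a, b]
   does not enter the formula, so it is not a parameter. The base of the power is a nonnegative
   real; the convention 0 powr s = 0 affects only the single point t = x. *)

definition rl_integral_left :: "real \<Rightarrow> complex \<Rightarrow> (real \<Rightarrow> complex) \<Rightarrow> real \<Rightarrow> complex" where
  "rl_integral_left a \<alpha> f x =
     1 / Gamma \<alpha> * (LINT t:{a..x}|lebesgue. complex_of_real (x - t) powr (\<alpha> - 1) * f t)"

definition rl_integral_right :: "real \<Rightarrow> complex \<Rightarrow> (real \<Rightarrow> complex) \<Rightarrow> real \<Rightarrow> complex" where
  "rl_integral_right b \<alpha> f x =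
     1 / Gamma \<alpha> * (LINT t:{x..b}|lebesgue. complex_of_real (t - x) powr (\<alpha> - 1) * f t)"

(* The m-fold repeated integral
     int_a^x int_a^{t_1} ... int_a^{t_{m-1}} f(t_m) dt_m ... dt_2 dt_1,
   where each unfolding of the recursion peels off the outermost integral. *)

primrec repeated_integral :: "real \<Rightarrow> nat \<Rightarrow> (real \<Rightarrow> real) \<Rightarrow> real \<Rightarrow> real" where
  "repeated_integral a 0 f x = f x"
| "repeated_integral a (Suc m) f x = (LINT t:{a..x}|lebesgue. repeated_integral a m f t)"

(* The real logarithm of Gamma on ]0, 1]; the value at 0 is an irrelevant convention. *)

definition log_Gamma :: "real \<Rightarrow> real" where
  "log_Gamma t = ln (Gamma t)"

end

theory Submission
  imports Defs "HOL-Real_Asymp.Real_Asymp"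
begin

text \<open>
  Both equalities pass through the single integral
  \<open>\<integral>\<^sub>0\<^sup>1 (1 - t)^(m-1)/(m-1)! t^(k-1) log \<Gamma>(t) dt\<close>.

  The fractional integral of integer order \<open>m\<close> is this integral by definition, because
  \<open>\<Gamma>(m) = (m-1)!\<close> and the complex power with exponent \<open>m - 1\<close> is an ordinary power off the end
  point of the interval (\<open>rl_integral_left_of_nat\<close>). The \<open>m\<close>-fold repeated integral equals it by
  Cauchy's formula (\<open>Cauchy_repeated_integration\<close>), an induction on \<open>m\<close> whose step exchanges the
  order of integration over the triangle \<open>a \<le> t \<le> s \<le> x\<close> (\<open>integral_over_triangle\<close>).

  For the sum, \<open>(1 - t)^(m-1)\<close> is expanded by the binomial theorem. The term with \<open>t^n\<close> contributes
  a multiple of \<open>\<integral>\<^sub>0\<^sup>1 t^(n+k-1) log \<Gamma>(t) dt\<close>, which is \<open>(n+k-1)!\<close> times the right-sided integral of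
  order \<open>n + k\<close> at 0; the quotient \<open>(n+k-1)!/n!\<close> that results is the product \<open>(n+k-1) \<cdots> (n+1)\<close>
  (\<open>binomial_kernel_expansion\<close>).

  Exchanging and splitting the integrals is justified by the absolute integrability of
  \<open>log \<Gamma>\<close> on \<open>[0,1]\<close> (\<open>log_Gamma_absolutely_integrable\<close>). The function is unbounded there, but
  \<open>log \<Gamma>(t) = log \<Gamma>(t + 1) - log t\<close>, so its singularity at 0 is that of the logarithm.
\<close>

section \<open>Cauchy's formula for repeated integration\<close>

lemma sigma_finite_lebesgue: "sigma_finite_measure (lebesgue :: 'a::euclidean_space measure)"
proof
  obtain A :: "'a set set" where A: "countable A" "A \<subseteq> sets lborel" "\<Union>A = space lborel"
      "\<forall>a\<in>A. emeasure lborel a \<noteq> \<infinity>"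
    using lborel.sigma_finite_countable by blast
  show "\<exists>A. countable A \<and> A \<subseteq> sets (lebesgue :: 'a measure) \<and> \<Union>A = space lebesgue \<and>
      (\<forall>a\<in>A. emeasure lebesgue a \<noteq> \<infinity>)"
    using A by (intro exI[of _ A]) (auto simp: subset_iff)
qed

lemma integral_power_kernel:
  fixes t x :: real
  assumes "t \<le> x"
  shows "(LINT s:{t..x}|lebesgue. (s - t) ^ m / fact m) = (x - t) ^ Suc m / fact (Suc m)"
proof -
  have "((\<lambda>s. (s - t) ^ m / fact m) has_integral
      (x - t) ^ Suc m / fact (Suc m) - (t - t) ^ Suc m / fact (Suc m)) {t..x}"
  proof (rule fundamental_theorem_of_calculus[OF assms])
    fix s
    show "((\<lambda>s. (s - t) ^ Suc m / fact (Suc m)) has_vector_derivative (s - t) ^ m / fact m)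
        (at s within {t..x})"
      by (auto intro!: derivative_eq_intros
          simp flip: has_real_derivative_iff_has_vector_derivative simp del: power_Suc)
  qed
  moreover have "(\<lambda>s. (s - t) ^ m / fact m) absolutely_integrable_on {t..x}"
    by (intro absolutely_integrable_continuous_real continuous_intros) auto
  ultimately show ?thesis
    by (simp only: set_lebesgue_integral_eq_integral(2) integral_unique) simp
qed

text \<open>
  Fubini's theorem for the triangle \<open>a \<le> t \<le> s \<le> x\<close>, described once as \<open>t \<in> [a,s]\<close> with \<open>s\<close> outermost
  and once as \<open>s \<in> [t,x]\<close> with \<open>t\<close> outermost. On the triangle the integrand is dominated by
  \<open>(x - a)^m/m! \<bar>f t\<bar>\<close>, which is integrable over the square.
\<close>
lemma integral_over_triangle:
  fixes f :: "real \<Rightarrow> real"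
  assumes f: "set_integrable lebesgue {a..x} f"
  shows "(LINT s:{a..x}|lebesgue. LINT t:{a..s}|lebesgue. (s - t) ^ m / fact m * f t)
       = (LINT t:{a..x}|lebesgue. (LINT s:{t..x}|lebesgue. (s - t) ^ m / fact m) * f t)"
proof -
  interpret L: sigma_finite_measure "lebesgue :: real measure"
    by (rule sigma_finite_lebesgue)
  interpret pair_sigma_finite "lebesgue :: real measure" "lebesgue :: real measure" ..
  define g where "g t = indicator {a..x} t * f t" for t
  have g: "integrable lebesgue g"
    using f by (simp add: g_def[abs_def] set_integrable_def)
  hence [measurable]: "g \<in> borel_measurable lebesgue" by simp
  \<comment> \<open>The coordinates are Borel functions although the factors carry the larger Lebesgue
    sigma-algebra; with this, polynomials and inequalities in \<open>s\<close> and \<open>t\<close> are measurable.\<close>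
  have [measurable]: "(\<lambda>s::real. s) \<in> borel_measurable lebesgue"
    by (simp add: measurable_completion)
  define h where "h s t = (if a \<le> s \<and> s \<le> x \<and> t \<le> s then (s - t) ^ m / fact m * g t else 0)" for s t
  define C where "C = (x - a) ^ m / fact m"
  have [measurable]: "fst \<in> borel_measurable ((lebesgue::real measure) \<Otimes>\<^sub>M (lebesgue::real measure))"
     "snd \<in> borel_measurable ((lebesgue::real measure) \<Otimes>\<^sub>M (lebesgue::real measure))"
    using measurable_compose[OF measurable_fst \<open>(\<lambda>s::real. s) \<in> borel_measurable lebesgue\<close>]
      measurable_compose[OF measurable_snd \<open>(\<lambda>s::real. s) \<in> borel_measurable lebesgue\<close>]
    by simp_all
  have ind: "integrable lebesgue (indicat_real {a..x})"
    by (rule integrable_real_indicator) (auto simp: emeasure_lborel_Icc_eq)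
  have "integrable (lebesgue \<Otimes>\<^sub>M lebesgue) (case_prod (\<lambda>s t. indicator {a..x} s * (C * g t)))"
  proof (rule Fubini_integrable)
    show "integrable lebesgue (\<lambda>s. LINT t|lebesgue. norm (case (s, t) of (s, t) \<Rightarrow> indicator {a..x} s * (C * g t)))"
      using ind by (auto simp: abs_mult)
    show "AE s in lebesgue. integrable lebesgue (\<lambda>t. case (s, t) of (s, t) \<Rightarrow> indicator {a..x} s * (C * g t))"
      using g by auto
    show "(\<lambda>(s, t). indicator {a..x} s * (C * g t)) \<in> borel_measurable (lebesgue \<Otimes>\<^sub>M lebesgue)"
      by measurable
  qed
  hence int: "integrable (lebesgue \<Otimes>\<^sub>M lebesgue) (case_prod h)"
  proof (rule Bochner_Integration.integrable_bound)
    show "case_prod h \<in> borel_measurable (lebesgue \<Otimes>\<^sub>M lebesgue)"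
      unfolding h_def by measurable
    have "norm (h s t) \<le> norm (indicator {a..x} s * (C * g t))" for s t
      unfolding h_def C_def g_def
      by (auto simp: indicator_def abs_mult intro!: mult_right_mono divide_right_mono power_mono)
    thus "AE p in lebesgue \<Otimes>\<^sub>M lebesgue. norm (case_prod h p)
        \<le> norm (case p of (s, t) \<Rightarrow> indicator {a..x} s * (C * g t))"
      by (intro AE_I2) auto
  qed
  have "(LINT s:{a..x}|lebesgue. LINT t:{a..s}|lebesgue. (s - t) ^ m / fact m * f t)
      = (LINT s|lebesgue. LINT t|lebesgue. h s t)"
    unfolding set_lebesgue_integral_def integral_scaleR_right[symmetric]
    by (intro Bochner_Integration.integral_cong)
       (auto simp: h_def g_def indicator_def intro!: Bochner_Integration.integral_cong)
  also have "\<dots> = (LINT t|lebesgue. LINT s|lebesgue. h s t)"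
    by (rule Fubini_integral[OF int, symmetric])
  also have "\<dots> = (LINT t:{a..x}|lebesgue. (LINT s:{t..x}|lebesgue. (s - t) ^ m / fact m) * f t)"
    unfolding set_lebesgue_integral_def integral_scaleR_right[symmetric]
      integral_mult_left_zero[symmetric]
    by (intro Bochner_Integration.integral_cong)
       (auto simp: h_def g_def indicator_def intro!: Bochner_Integration.integral_cong)
  finally show ?thesis .
qed

text \<open>
  The induction peels off the outermost integral: inserting the formula for \<open>m\<close> and exchanging the
  integrals leaves the kernel \<open>(s - t)^m/m!\<close> to be integrated in \<open>s\<close> over \<open>[t,x]\<close>, which gives the
  next kernel \<open>(x - t)^(m+1)/(m+1)!\<close>.
\<close>
lemma Cauchy_repeated_integration:
  assumes f: "set_integrable lebesgue {a..b} f" and "x \<le> b"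
  shows "repeated_integral a (Suc m) f x = (LINT t:{a..x}|lebesgue. (x - t) ^ m / fact m * f t)"
  using \<open>x \<le> b\<close>
proof (induction m arbitrary: x)
  case 0
  then show ?case by simp
next
  case (Suc m)
  have fx: "set_integrable lebesgue {a..x} f"
    using f Suc.prems by (rule_tac set_integrable_subset) auto
  have "repeated_integral a (Suc (Suc m)) f x
      = (LINT s:{a..x}|lebesgue. repeated_integral a (Suc m) f s)"
    by simp
  also have "\<dots> = (LINT s:{a..x}|lebesgue. LINT t:{a..s}|lebesgue. (s - t) ^ m / fact m * f t)"
    using Suc by (intro set_lebesgue_integral_cong) (auto simp del: repeated_integral.simps)
  also have "\<dots> = (LINT t:{a..x}|lebesgue. (LINT s:{t..x}|lebesgue. (s - t) ^ m / fact m) * f t)"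
    by (rule integral_over_triangle[OF fx])
  also have "\<dots> = (LINT t:{a..x}|lebesgue. (x - t) ^ Suc m / fact (Suc m) * f t)"
    by (intro set_lebesgue_integral_cong) (auto simp only: integral_power_kernel atLeastAtMost_iff sets_completionI_sets
        sets_lborel borel_closed closed_atLeastAtMost)
  finally show ?case .
qed

section \<open>Integrability of the log-gamma function\<close>

text \<open>
  The antiderivative \<open>t - t ln t\<close> of \<open>- ln t\<close> extends continuously to 0, so \<open>- ln t\<close> has a (possibly
  only conditionally convergent) integral; as it is nonnegative on the unit interval, the
  convergence is absolute.
\<close>
lemma ln_absolutely_integrable: "ln absolutely_integrable_on {0..1::real}"
proof -
  have "((\<lambda>t::real. - ln t) has_integral (1 - 1 * ln 1) - (0 - 0 * ln 0)) {0..1}"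
  proof (rule fundamental_theorem_of_calculus_interior)
    have "((\<lambda>t::real. t - t * ln t) \<longlongrightarrow> 0) (at_right 0)"
      by real_asymp
    hence "continuous (at 0 within {0..}) (\<lambda>t::real. t - t * ln t)"
      by (simp add: continuous_within at_within_Ici_at_right)
    moreover have "continuous (at t within {0..}) (\<lambda>t::real. t - t * ln t)" if "t > 0" for t
      using that by (intro continuous_intros) auto
    \<comment> \<open>At the end point the factor \<open>t\<close> makes the value equal to the limit 0.\<close>
    ultimately have "continuous_on {0..} (\<lambda>t::real. t - t * ln t)"
      unfolding continuous_on_eq_continuous_within by (metis atLeast_iff order_le_less)
    thus "continuous_on {0..1} (\<lambda>t::real. t - t * ln t)"
      by (rule continuous_on_subset) auto
  qed (auto intro!: derivative_eq_intros simp flip: has_real_derivative_iff_has_vector_derivative)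
  hence "(\<lambda>t::real. - ln t) absolutely_integrable_on {0..1}"
    by (intro nonnegative_absolutely_integrable_1) (auto simp: has_integral_iff order_le_less[of "0::real"])
  from set_integrable_mult_right[of "-1", OF this] show ?thesis by simp
qed

lemma log_Gamma_absolutely_integrable: "log_Gamma absolutely_integrable_on {0..1}"
proof -
  have "continuous_on {0..1} (\<lambda>t::real. ln (Gamma (t + 1)))"
    by (intro continuous_intros continuous_on_compose2[OF continuous_on_Gamma[of "{0<..}"]])
       (auto simp: less_imp_neq[OF Gamma_real_pos, symmetric] elim!: nonpos_Ints_cases)
  hence "(\<lambda>t::real. ln (Gamma (t + 1))) absolutely_integrable_on {0..1}"
    by (rule absolutely_integrable_continuous_real)
  hence "(\<lambda>t::real. ln (Gamma (t + 1)) - ln t) absolutely_integrable_on {0..1}"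
    using ln_absolutely_integrable by (rule set_integral_diff(1))
  thus ?thesis
  proof (rule absolutely_integrable_spike)
    show "log_Gamma t = ln (Gamma (t + 1)) - ln t" if "t \<in> {0..1} - {0}" for t
      using that Gamma_real_pos[of t] by (simp del: Gamma_real_pos add: log_Gamma_def Gamma_plus1 ln_mult nonpos_Ints_def)
  qed auto
qed

section \<open>Fractional integrals of integer order\<close>

lemma set_lebesgue_integral_spike:
  fixes f g :: "'a::euclidean_space \<Rightarrow> 'b::euclidean_space"
  assumes g: "g absolutely_integrable_on S" and N: "negligible N"
    and eq: "\<And>x. x \<in> S - N \<Longrightarrow> f x = g x"
  shows "(LINT x:S|lebesgue. f x) = (LINT x:S|lebesgue. g x)"
proof -
  have "f absolutely_integrable_on S"
    using absolutely_integrable_spike[OF g N eq] .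
  moreover have "integral S f = integral S g"
    using N eq by (intro integral_spike) auto
  ultimately show ?thesis
    using g by (simp add: set_lebesgue_integral_eq_integral(2))
qed

lemma absolutely_integrable_continuous_mult:
  fixes f p :: "real \<Rightarrow> real"
  assumes "f absolutely_integrable_on {a..b}" and p: "continuous_on {a..b} p"
  shows "(\<lambda>t. p t * f t) absolutely_integrable_on {a..b}"
proof (rule absolutely_integrable_bounded_measurable_product_real)
  show "p \<in> borel_measurable (lebesgue_on {a..b})"
    by (intro continuous_imp_measurable_on_sets_lebesgue p) auto
  show "bounded (p ` {a..b})"
    by (intro compact_imp_bounded compact_continuous_image p) auto
qed (use assms in auto)

lemma of_real_powr_minus_1:
  assumes "y > 0"
  shows "complex_of_real y powr (of_nat (Suc m) - 1) = complex_of_real (y ^ m)"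
  using assms by (simp add: powr_nat')

text \<open>
  The two integrands agree except possibly at \<open>t = x\<close>: for \<open>m = 0\<close> the complex power there is
  \<open>0 powr 0 = 0\<close>, while \<open>0 ^ 0 = 1\<close>. One point does not affect the integral. The same happens in
  the right-sided case.
\<close>
lemma rl_integral_left_of_nat:
  assumes f: "f absolutely_integrable_on {a..x}"
  shows "rl_integral_left a (of_nat (Suc m)) (\<lambda>t. complex_of_real (f t)) x
       = complex_of_real (LINT t:{a..x}|lebesgue. (x - t) ^ m / fact m * f t)"
proof -
  have "(\<lambda>t. (x - t) ^ m * f t) absolutely_integrable_on {a..x}"
    by (intro absolutely_integrable_continuous_mult f continuous_intros)
  hence "(\<lambda>t. complex_of_real ((x - t) ^ m * f t)) absolutely_integrable_on {a..x}"
    by (rule absolutely_integrable_linear[OF _ bounded_linear_of_real, unfolded o_def])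
  hence "(LINT t:{a..x}|lebesgue. complex_of_real (x - t) powr (of_nat (Suc m) - 1) * complex_of_real (f t))
      = (LINT t:{a..x}|lebesgue. complex_of_real ((x - t) ^ m * f t))"
    by (rule set_lebesgue_integral_spike[of _ _ "{x}"])
       (simp_all add: of_real_powr_minus_1 flip: of_real_diff del: of_nat_Suc)
  thus ?thesis
    unfolding rl_integral_left_def set_integral_complex_of_real
    by (simp add: Gamma_fact)
qed

lemma rl_integral_right_of_nat:
  assumes f: "f absolutely_integrable_on {x..b}"
  shows "rl_integral_right b (of_nat (Suc m)) (\<lambda>t. complex_of_real (f t)) x
       = complex_of_real (LINT t:{x..b}|lebesgue. (t - x) ^ m / fact m * f t)"
proof -
  have "(\<lambda>t. (t - x) ^ m * f t) absolutely_integrable_on {x..b}"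
    by (intro absolutely_integrable_continuous_mult f continuous_intros)
  hence "(\<lambda>t. complex_of_real ((t - x) ^ m * f t)) absolutely_integrable_on {x..b}"
    by (rule absolutely_integrable_linear[OF _ bounded_linear_of_real, unfolded o_def])
  hence "(LINT t:{x..b}|lebesgue. complex_of_real (t - x) powr (of_nat (Suc m) - 1) * complex_of_real (f t))
      = (LINT t:{x..b}|lebesgue. complex_of_real ((t - x) ^ m * f t))"
    by (rule set_lebesgue_integral_spike[of _ _ "{x}"])
       (simp_all add: of_real_powr_minus_1 flip: of_real_diff del: of_nat_Suc)
  thus ?thesis
    unfolding rl_integral_right_def set_integral_complex_of_real
    by (simp add: Gamma_fact)
qed

section \<open>Repeated integrals as sums of right-sided integrals\<close>

lemma fact_mult_prod_Suc_to_add: "fact n * (\<Prod>i = n + 1..n + k. i) = (fact (n + k) :: nat)"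
  by (induction k) (simp_all add: algebra_simps)

text \<open>
  The summands are arranged as a constant times \<open>t^(n+k)/(n+k)!\<close>, the kernel at 0 of the
  right-sided integral of order \<open>n + k + 1\<close>.
\<close>
lemma binomial_kernel_expansion:
  fixes t :: real
  shows "(1 - t) ^ m / fact m * t ^ k =
    (\<Sum>n = 0..m. (-1) ^ n * (real (\<Prod>i = n + 1..n + k. i) / fact (m - n)) * (t ^ (n + k) / fact (n + k)))"
proof -
  have "(1 - t) ^ m = (\<Sum>n = 0..m. real (m choose n) * (- t) ^ n)"
    using binomial_ring[of "- t" 1 m] by (simp add: atMost_atLeast0)
  hence "(1 - t) ^ m / fact m * t ^ k = (\<Sum>n = 0..m. real (m choose n) * (- t) ^ n / fact m * t ^ k)"
    by (simp add: sum_divide_distrib sum_distrib_right)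
  also have "\<dots> = (\<Sum>n = 0..m. (-1) ^ n * (real (\<Prod>i = n + 1..n + k. i) / fact (m - n)) * (t ^ (n + k) / fact (n + k)))"
  proof (rule sum.cong[OF refl])
    fix n assume "n \<in> {0..m}"
    hence "real (m choose n) = fact m / (fact n * fact (m - n))"
      by (simp add: binomial_fact)
    moreover have "real (\<Prod>i = n + 1..n + k. i) = fact (n + k) / fact n"
      using arg_cong[OF fact_mult_prod_Suc_to_add[of n k], of real] by (simp add: field_simps del: of_nat_prod of_nat_add)
    ultimately show "real (m choose n) * (- t) ^ n / fact m * t ^ k
       = (-1) ^ n * (real (\<Prod>i = n + 1..n + k. i) / fact (m - n)) * (t ^ (n + k) / fact (n + k))"
      by (simp add: power_add power_minus[of t n] del: of_nat_prod)
  qed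
  finally show ?thesis .
qed

theorem corollary3p3:
  fixes m k :: nat
  assumes "m \<ge> 1" and "k \<ge> 1"
  shows "rl_integral_left 0 (of_nat m) (\<lambda>x. complex_of_real (x ^ (k - 1) * log_Gamma x)) 1
           = complex_of_real (repeated_integral 0 m (\<lambda>t. t ^ (k - 1) * log_Gamma t) 1)
       \<and> complex_of_real (repeated_integral 0 m (\<lambda>t. t ^ (k - 1) * log_Gamma t) 1)
           = (\<Sum>n = 0..m - 1. (- 1) ^ n * (of_nat (\<Prod>i = n + 1..n + k - 1. i) / fact (m - 1 - n))
                * rl_integral_right 1 (of_nat (n + k)) (\<lambda>t. complex_of_real (log_Gamma t)) 0)"
proof -
  obtain M K where mk: "m = Suc M" "k = Suc K"
    using assms by (metis One_nat_def Suc_le_D)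
  define f where "f t = t ^ K * log_Gamma t" for t
  define c where "c n = (-1) ^ n * (real (\<Prod>i = n + 1..n + K. i) / fact (M - n))" for n
  define J where "J n = (LINT t:{0..1}|lebesgue. t ^ n / fact n * log_Gamma t)" for n
  note lg = log_Gamma_absolutely_integrable
  have f: "f absolutely_integrable_on {0..1}"
    unfolding f_def by (intro absolutely_integrable_continuous_mult lg continuous_intros)
  have cauchy: "repeated_integral 0 m f 1 = (LINT t:{0..1}|lebesgue. (1 - t) ^ M / fact M * f t)"
    unfolding mk using f by (rule Cauchy_repeated_integration) simp
  have J: "rl_integral_right 1 (of_nat (n + k)) (\<lambda>t. complex_of_real (log_Gamma t)) 0
      = complex_of_real (J (n + K))" for n
    using rl_integral_right_of_nat[OF lg, of "n + K"] by (simp add: mk J_def)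
  have "(LINT t:{0..1}|lebesgue. (1 - t) ^ M / fact M * f t)
      = (LINT t:{0..1}|lebesgue. \<Sum>n = 0..M. c n * (t ^ (n + K) / fact (n + K) * log_Gamma t))"
    using binomial_kernel_expansion[of _ M K]
    by (simp only: f_def c_def mult.assoc[symmetric] sum_distrib_right)
  also have "\<dots> = (\<Sum>n = 0..M. LINT t:{0..1}|lebesgue. c n * (t ^ (n + K) / fact (n + K) * log_Gamma t))"
    unfolding set_lebesgue_integral_def scaleR_sum_right
  proof (intro Bochner_Integration.integral_sum)
    fix n
    have "(\<lambda>t. c n * (t ^ (n + K) / fact (n + K) * log_Gamma t)) absolutely_integrable_on {0..1}"
      by (intro set_integrable_mult_right absolutely_integrable_continuous_mult lg continuous_intros) auto
    thus "integrable lebesgue (\<lambda>t. indicator {0..1} t *\<^sub>R (c n * (t ^ (n + K) / fact (n + K) * log_Gamma t)))"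
      unfolding set_integrable_def .
  qed
  also have "\<dots> = (\<Sum>n = 0..M. c n * J (n + K))"
    by (simp only: set_integral_mult_right J_def)
  finally have "complex_of_real (repeated_integral 0 m f 1) = (\<Sum>n = 0..M. complex_of_real (c n) * complex_of_real (J (n + K)))"
    unfolding cauchy by simp
  moreover have "complex_of_real (c n) = (-1) ^ n * (of_nat (\<Prod>i = n + 1..n + k - 1. i) / fact (m - 1 - n))" for n
    by (simp add: c_def mk)
  ultimately have "complex_of_real (repeated_integral 0 m f 1)
      = (\<Sum>n = 0..m - 1. (- 1) ^ n * (of_nat (\<Prod>i = n + 1..n + k - 1. i) / fact (m - 1 - n))
           * rl_integral_right 1 (of_nat (n + k)) (\<lambda>t. complex_of_real (log_Gamma t)) 0)"
    by (simp only: J) (simp add: mk)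
  moreover have "rl_integral_left 0 (of_nat m) (\<lambda>x. complex_of_real (f x)) 1 = complex_of_real (repeated_integral 0 m f 1)"
    unfolding cauchy unfolding mk by (rule rl_integral_left_of_nat[OF f])
  ultimately show ?thesis
    by (simp add: f_def[abs_def] mk)
qed

end
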